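(* Let $\mathscr{H}$ be a complex Hilbert space, let $A,B,X\in\mathbb{B}(\mathscr{H})$, and suppose $0<mI\leq X$ for some positive real number $m$. Then $$\begin{aligned} m\Vert \mathrm{Re}(A)-\mathrm{Re}(B)\Vert &\leq w(\mathrm{Re}(A)X-X\,\mathrm{Re}(B))\\ &\leq \frac12\sup_{\theta\in\mathbb{R}}\left\Vert (AX-XB)+e^{i\theta}(XA-BX)\right\Vert\\ &\leq \frac{\Vert AX-XB\Vert+\Vert XA-BX\Vert}{2}.\end{aligned}$$
   Context: $\mathbb{B}(\mathscr{H})$ is the $C^*$-algebra of bounded linear operators on the complex Hilbert space $\mathscr{H}$, $I$ is the identity operator, and $\Vert\cdot\Vert$ is the operator norm. For $T\in\mathbb{B}(\mathscr{H})$, $\mathrm{Re}(T)=\frac{T+T^*}{2}$. An operator $S$ is positive ($S\geq0$) if $\langle Sx,x\rangle\geq0$ for all $x\in\mathscr{H}$, and $mI\leq X$ means $X-mI\geq0$ (so $X$ is self-adjoint). The numerical radius of $S\in\mathbb{B}(\mathscr{H})$ is $w(S)=\sup\{|\langle Sx,x\rangle| : x\in\mathscr{H},\ \Vert x\Vert=1\}$. *)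

theory Defs
  imports "HOL-Analysis.Analysis"
begin

text \<open>
  The underlying real structure is reused: \<^class>\<open>real_inner\<close> supplies the norm and the
  real inner product, which is required to be the real part of the complex one.
  Definiteness of \<open>cinner\<close> and \<open>norm x = sqrt (Re (cinner x x))\<close> follow from this.
  The complex inner product is linear in its first argument.
\<close>

class complex_vector = real_vector +
  fixes scaleC :: "complex \<Rightarrow> 'a \<Rightarrow> 'a"  (infixr "*\<^sub>C" 75)
  assumes scaleR_scaleC: "r *\<^sub>R x = complex_of_real r *\<^sub>C x"
    and scaleC_add_right: "a *\<^sub>C (x + y) = a *\<^sub>C x + a *\<^sub>C y"
    and scaleC_add_left: "(a + b) *\<^sub>C x = a *\<^sub>C x + b *\<^sub>C x"
    and scaleC_scaleC: "a *\<^sub>C (b *\<^sub>C x) = (a * b) *\<^sub>C x"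
    and scaleC_one: "1 *\<^sub>C x = x"

class complex_inner = complex_vector + real_inner +
  fixes cinner :: "'a \<Rightarrow> 'a \<Rightarrow> complex"
  assumes cinner_commute: "cinner x y = cnj (cinner y x)"
    and cinner_add_left: "cinner (x + y) z = cinner x z + cinner y z"
    and cinner_scaleC_left: "cinner (c *\<^sub>C x) y = c * cinner x y"
    and inner_eq_Re_cinner: "inner x y = Re (cinner x y)"

class chilbert_space = complex_inner + complete_space

lemma cinner_self: "cinner x x = complex_of_real ((norm (x::'a::complex_inner))\<^sup>2)"
proof -
  have "Im (cinner x x) = - Im (cinner x x)"
    using arg_cong[OF cinner_commute[of x x], of Im] by simp
  then show ?thesis
    by (simp add: complex_eq_iff power2_norm_eq_inner inner_eq_Re_cinner)
qed

lemma norm_eq_sqrt_cinner: "norm (x::'a::complex_inner) = sqrt (Re (cinner x x))"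
  by (simp add: cinner_self)

lemma cinner_eq_zero_iff: "cinner x x = 0 \<longleftrightarrow> (x::'a::complex_inner) = 0"
  by (simp add: cinner_self)

instantiation complex :: chilbert_space
begin

definition scaleC_complex :: "complex \<Rightarrow> complex \<Rightarrow> complex"
  where "scaleC_complex = (*)"

definition cinner_complex :: "complex \<Rightarrow> complex \<Rightarrow> complex"
  where "cinner_complex x y = x * cnj y"

instance
  by standard (auto simp: scaleC_complex_def cinner_complex_def algebra_simps
      scaleR_conv_of_real inner_complex_def)

end

text \<open>
  Elements of \<open>\<bool>(H)\<close> are functions satisfying the following predicate; their operator norm is
  \<^const>\<open>onorm\<close>.
\<close>

definition bounded_clinear :: "('a::complex_inner \<Rightarrow> 'a) \<Rightarrow> bool"
  where "bounded_clinear T \<longleftrightarrow> bounded_linear T \<and> (\<forall>c x. T (c *\<^sub>C x) = c *\<^sub>C T x)"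

definition cadjoint :: "('a::complex_inner \<Rightarrow> 'a) \<Rightarrow> 'a \<Rightarrow> 'a"
  where "cadjoint T = (THE S. \<forall>x y. cinner (T x) y = cinner x (S y))"

definition re_op :: "('a::complex_inner \<Rightarrow> 'a) \<Rightarrow> 'a \<Rightarrow> 'a"
  where "re_op T = (\<lambda>x. (1/2) *\<^sub>C (T x + cadjoint T x))"

text \<open>Membership in \<open>\<real>\<^sub>\<ge>\<^sub>0\<close> says that the complex number is real and nonnegative.\<close>

definition positive_op :: "('a::complex_inner \<Rightarrow> 'a) \<Rightarrow> bool"
  where "positive_op S \<longleftrightarrow> bounded_clinear S \<and> (\<forall>x. cinner (S x) x \<in> \<real>\<^sub>\<ge>\<^sub>0)"

text \<open>
  On the zero space there are no unit vectors, and \<open>Sup {} :: real\<close> is unspecified;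
  the supremum (of a set of nonnegative numbers) is then 0.
\<close>

definition numerical_radius :: "('a::complex_inner \<Rightarrow> 'a) \<Rightarrow> real"
  where "numerical_radius S =
    (if {x::'a. norm x = 1} = {} then 0 else SUP x\<in>{x. norm x = 1}. cmod (cinner (S x) x))"

end

theory Submission
  imports Defs
begin

text \<open>
  Put \<open>P = Re A\<close>, \<open>Q = Re B\<close>, \<open>R = P - Q\<close>. For the first inequality, the real part of
  \<open>\<langle>(PX - XQ)x, x\<rangle>\<close> is \<open>Re \<langle>Xx, Rx\<rangle>\<close>. The self-adjoint operator \<open>R\<close> has approximate
  eigenvectors \<open>x\<close> for \<open>\<mu> = \<parallel>R\<parallel>\<close> or \<open>\<mu> = -\<parallel>R\<parallel>\<close>, and there \<open>\<langle>Xx, Rx\<rangle>\<close> is close to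
  \<open>\<mu> \<langle>Xx, x\<rangle>\<close>, of modulus at least \<open>m \<parallel>R\<parallel>\<close>.

  For the second, \<open>2 (PX - XQ) = C + D\<^sup>*\<close> with \<open>C = AX - XB\<close> and \<open>D = XA - BX\<close>, so
  \<open>2 \<langle>(PX - XQ)x, x\<rangle>\<close> is the sum of \<open>\<langle>Cx, x\<rangle>\<close> and the conjugate of \<open>\<langle>Dx, x\<rangle>\<close>; for each \<open>x\<close>
  that conjugate equals \<open>exp (\<i>\<theta>) \<langle>Dx, x\<rangle>\<close> for a suitable \<open>\<theta>\<close>.
\<close>

subsection \<open>Complex inner products\<close>

lemma cinner_add_right: "cinner x (y + z) = cinner x y + cinner x z"
  by (metis cinner_add_left cinner_commute complex_cnj_add)

lemma cinner_scaleC_right: "cinner x (c *\<^sub>C y) = cnj c * cinner x y"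
  by (metis cinner_scaleC_left cinner_commute complex_cnj_mult)

lemma cinner_scaleR_left: "cinner (r *\<^sub>R x) y = of_real r * cinner x y"
  by (simp add: scaleR_scaleC cinner_scaleC_left)

lemma cinner_minus_left: "cinner (- x) y = - cinner x y"
  using cinner_scaleR_left[of "-1" x y] by simp

lemma cinner_diff_left: "cinner (x - y) z = cinner x z - cinner y z"
  using cinner_add_left[of x "- y" z] by (simp add: cinner_minus_left)

lemma cinner_diff_right: "cinner x (y - z) = cinner x y - cinner x z"
  by (metis cinner_diff_left cinner_commute complex_cnj_diff)

lemma norm_scaleC: "norm (c *\<^sub>C x) = cmod c * norm (x::'a::complex_inner)"
proof -
  have "complex_of_real ((norm (c *\<^sub>C x))\<^sup>2) = (c * cnj c) * cinner x x"
    unfolding cinner_self[symmetric] by (simp add: cinner_scaleC_left cinner_scaleC_right)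
  also have "\<dots> = complex_of_real ((cmod c * norm x)\<^sup>2)"
    unfolding complex_norm_square[symmetric] cinner_self by (simp add: power_mult_distrib)
  finally have "(norm (c *\<^sub>C x))\<^sup>2 = (cmod c * norm x)\<^sup>2"
    by (simp only: of_real_eq_iff)
  then show ?thesis by simp
qed

lemma cmod_cinner_le: "cmod (cinner x y) \<le> norm x * norm (y::'a::complex_inner)"
proof (cases "cinner x y = 0")
  case False
  \<comment> \<open>Multiplying \<open>x\<close> by this unimodular number makes the inner product
    real and nonnegative, so the real Cauchy-Schwarz inequality applies.\<close>
  define u where "u = cnj (cinner x y) / cmod (cinner x y)"
  have u: "cmod u = 1" using False by (simp add: u_def norm_divide)
  have "cmod (cinner x y) = Re (u * cinner x y)"
    using False by (simp add: u_def cmod_power2[symmetric] power2_eq_square[symmetric])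
      (simp add: power2_eq_square)
  also have "\<dots> = inner (u *\<^sub>C x) y"
    by (simp add: inner_eq_Re_cinner cinner_scaleC_left)
  also have "\<dots> \<le> norm (u *\<^sub>C x) * norm y" by (rule norm_cauchy_schwarz)
  finally show ?thesis by (simp add: norm_scaleC u)
qed simp

text \<open>Lets an identity of real inner products that holds for all \<open>x\<close> be upgraded
  to the complex one by testing it at \<open>\<i> *\<^sub>C x\<close> too.\<close>

lemma Im_cinner: "Im (cinner x y) = - inner (\<i> *\<^sub>C x) y"
  by (simp add: inner_eq_Re_cinner cinner_scaleC_left)

lemma cinner_ext:
  assumes "\<And>x. cinner x y = cinner x z" shows "y = z"
proof -
  have "cinner (y - z) (y - z) = 0"
    using assms[of "y - z"] by (simp add: cinner_diff_right)
  then show ?thesis by (simp add: cinner_eq_zero_iff)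
qed

subsection \<open>Riesz representation and adjoints\<close>

text \<open>The representing vector minimises \<open>\<parallel>x\<parallel>\<^sup>2 - 2 f x\<close>; the parallelogram law makes every
  minimising sequence Cauchy.\<close>

lemma riesz_representation:
  fixes f :: "'a::{real_inner,complete_space} \<Rightarrow> real"
  assumes f: "bounded_linear f"
  obtains z where "\<And>x. f x = inner x z"
proof -
  interpret f: bounded_linear f by (rule f)
  define J where "J x = (norm x)\<^sup>2 - 2 * f x" for x
  obtain K where K: "\<And>x. \<bar>f x\<bar> \<le> norm x * K" using f.bounded by auto
  have "J x \<ge> - K\<^sup>2" for x
  proof -
    have "J x \<ge> (norm x)\<^sup>2 - 2 * (norm x * K)" using K[of x] by (simp add: J_def)
    moreover have "(norm x - K)\<^sup>2 \<ge> 0" by simp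
    ultimately show ?thesis by (simp add: power2_diff)
  qed
  then have bdd: "bdd_below (range J)" by (intro bdd_belowI2)
  define d where "d = (INF x. J x)"
  have d: "d \<le> J x" for x unfolding d_def by (rule cINF_lower[OF bdd]) simp
  have "\<exists>x. J x < d + inverse (real (Suc n))" for n
    using cINF_less_iff[OF _ bdd, of "d + inverse (real (Suc n))"] unfolding d_def by auto
  then obtain x where x: "\<And>n. J (x n) < d + inverse (real (Suc n))" by metis
  \<comment> \<open>The midpoint value is at least \<open>d\<close>, so near-minimality of
    \<open>J u\<close> and \<open>J v\<close> forces \<open>u\<close> and \<open>v\<close> close
    together.\<close>
  have parallelogram: "(norm (u - v))\<^sup>2 = 2 * J u + 2 * J v - 4 * J ((1/2) *\<^sub>R (u + v))" for u v
    unfolding J_def power2_norm_eq_inner f.scaleR f.add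
    by (simp add: inner_simps inner_commute field_simps)
  have dist_bound: "(norm (x n - x k))\<^sup>2 < 2 * inverse (real (Suc n)) + 2 * inverse (real (Suc k))"
    for n k using x[of n] x[of k] d[of "(1/2) *\<^sub>R (x n + x k)"] parallelogram[of "x n" "x k"] by simp
  have "Cauchy x"
  proof (rule metric_CauchyI)
    fix e :: real assume "e > 0"
    then have "e\<^sup>2 / 4 > 0" by simp
    then obtain N where N: "inverse (real (Suc N)) < e\<^sup>2 / 4" using reals_Archimedean by blast
    have "dist (x n) (x k) < e" if "n \<ge> N" "k \<ge> N" for n k
    proof -
      have "inverse (real (Suc n)) \<le> inverse (real (Suc N))"
        and "inverse (real (Suc k)) \<le> inverse (real (Suc N))"
        using that by (auto intro!: le_imp_inverse_le)
      then have "(norm (x n - x k))\<^sup>2 < e\<^sup>2" using dist_bound[of n k] N by linarith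
      then show ?thesis using \<open>e > 0\<close> by (simp add: dist_norm power_less_imp_less_base)
    qed
    then show "\<exists>M. \<forall>m\<ge>M. \<forall>n\<ge>M. dist (x m) (x n) < e" by blast
  qed
  then obtain z where z: "x \<longlonglongrightarrow> z" using Cauchy_convergent convergent_def by blast
  have "(\<lambda>n. J (x n)) \<longlonglongrightarrow> J z"
    unfolding J_def by (intro tendsto_intros f.tendsto z)
  moreover have "(\<lambda>n. d + inverse (real (Suc n))) \<longlonglongrightarrow> d + 0"
    by (intro tendsto_intros LIMSEQ_inverse_real_of_nat)
  ultimately have "J z \<le> d + 0"
    by (rule LIMSEQ_le) (use x in \<open>auto intro: less_imp_le simp del: of_nat_Suc\<close>)
  then have min: "J z \<le> J y" for y using d[of y] by simp
  have "f y = inner y z" for y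
  proof -
    \<comment> \<open>The right side is \<open>J (z + t *\<^sub>R y) - J z\<close>; its linear
      coefficient must vanish.\<close>
    have quad: "0 \<le> t\<^sup>2 * (norm y)\<^sup>2 + 2 * t * (inner y z - f y)" for t
      using min[of "z + t *\<^sub>R y"] unfolding J_def power2_norm_eq_inner f.scaleR f.add
      by (simp add: inner_simps inner_commute power2_eq_square algebra_simps)
    define a where "a = inner y z - f y"
    \<comment> \<open>The summand 1 keeps \<open>s\<close> positive when \<open>y = 0\<close> and
      turns the factor \<open>(norm y)\<^sup>2 - 2 * s\<close> into
      \<open>- (1 + s)\<close>.\<close>
    define s where "s = 1 + (norm y)\<^sup>2"
    have s: "s > 0" by (simp add: s_def add_pos_nonneg)
    have "0 \<le> (- a / s)\<^sup>2 * (norm y)\<^sup>2 + 2 * (- a / s) * a" using quad[of "- a / s"] by (simp add: a_def)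
    then have "0 \<le> s\<^sup>2 * ((- a / s)\<^sup>2 * (norm y)\<^sup>2 + 2 * (- a / s) * a)" by simp
    also have "\<dots> = a\<^sup>2 * ((norm y)\<^sup>2 - 2 * s)" using s
      by (simp add: field_simps power2_eq_square)
    also have "\<dots> = - (a\<^sup>2 * (1 + s))" by (simp add: s_def algebra_simps)
    finally have "a\<^sup>2 * (1 + s) \<le> 0" by simp
    then have "a = 0" using s by (auto simp: mult_le_0_iff)
    then show ?thesis by (simp add: a_def)
  qed
  then show thesis by (rule that)
qed

text \<open>Riesz gives a vector for the real functional, and complex linearity of \<open>T\<close>
  extends the identity to imaginary parts. Nondegeneracy makes the adjoint unique, as the
  \<open>THE\<close> in \<open>cadjoint\<close> demands.\<close>

lemma cinner_cadjoint:
  fixes T :: "'a::chilbert_space \<Rightarrow> 'a"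
  assumes T: "bounded_clinear T"
  shows "cinner (T x) y = cinner x (cadjoint T y)"
proof -
  have lin: "bounded_linear T" and hom: "\<And>c x. T (c *\<^sub>C x) = c *\<^sub>C T x"
    using T by (auto simp: bounded_clinear_def)
  have "\<exists>z. \<forall>x. cinner (T x) y = cinner x z" for y
  proof -
    have "bounded_linear (\<lambda>x. inner (T x) y)"
      by (rule bounded_linear_compose[OF bounded_linear_inner_left lin])
    then obtain z where z: "\<And>x. inner (T x) y = inner x z" by (rule riesz_representation) blast
    have "cinner (T x) y = cinner x z" for x
      using z[of x] z[of "\<i> *\<^sub>C x"]
      by (intro complex_eqI) (simp_all add: Im_cinner hom flip: inner_eq_Re_cinner)
    then show ?thesis by blast
  qed
  then obtain S where S: "\<forall>x y. cinner (T x) y = cinner x (S y)" by metis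
  have "cadjoint T = S" unfolding cadjoint_def
  proof (rule the_equality)
    fix S' assume "\<forall>x y. cinner (T x) y = cinner x (S' y)"
    with S have "cinner x (S' y) = cinner x (S y)" for x y by metis
    then show "S' = S" by (intro ext) (rule cinner_ext)
  qed (rule S)
  with S show ?thesis by simp
qed

lemma bounded_linear_cadjoint:
  fixes T :: "'a::chilbert_space \<Rightarrow> 'a"
  assumes T: "bounded_clinear T"
  shows "bounded_linear (cadjoint T)"
proof -
  note adj = cinner_cadjoint[OF T]
  have lin: "bounded_linear T" using T by (simp add: bounded_clinear_def)
  show ?thesis
  proof (rule bounded_linear_intro)
    show "cadjoint T (x + y) = cadjoint T x + cadjoint T y" for x y
      by (rule cinner_ext) (simp add: adj[symmetric] cinner_add_right)
    show "cadjoint T (r *\<^sub>R x) = r *\<^sub>R cadjoint T x" for r x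
      by (rule cinner_ext) (simp add: adj[symmetric] scaleR_scaleC cinner_scaleC_right)
    show "norm (cadjoint T y) \<le> norm y * onorm T" for y
    proof (cases "cadjoint T y = 0")
      case True
      then show ?thesis by (simp add: onorm_pos_le[OF lin])
    next
      case False
      \<comment> \<open>Testing the adjoint identity at \<open>cadjoint T y\<close> itself yields a
        bound from which one factor of its norm cancels.\<close>
      have "norm (cadjoint T y) * norm (cadjoint T y) = inner (T (cadjoint T y)) y"
        using adj[of "cadjoint T y" y]
        by (simp add: inner_eq_Re_cinner cinner_self power2_eq_square)
      also have "\<dots> \<le> norm (T (cadjoint T y)) * norm y" by (rule norm_cauchy_schwarz)
      also have "\<dots> \<le> onorm T * norm (cadjoint T y) * norm y"
        by (intro mult_right_mono onorm lin) simp
      finally show ?thesis using False by (simp add: mult.commute mult.left_commute)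
    qed
  qed
qed

section \<open>Real parts of operators and self-adjointness\<close>

lemma re_op_eq: "re_op T x = (1/2) *\<^sub>R (T x + cadjoint T x)"
  by (simp add: re_op_def scaleR_scaleC)

lemma bounded_linear_re_op:
  fixes T :: "'a::chilbert_space \<Rightarrow> 'a"
  assumes T: "bounded_clinear T"
  shows "bounded_linear (re_op T)"
proof -
  have "bounded_linear T" using T by (simp add: bounded_clinear_def)
  then show ?thesis unfolding re_op_eq[abs_def]
    by (intro bounded_linear_const_scaleR bounded_linear_add bounded_linear_cadjoint[OF T])
qed

lemma cinner_cadjoint':
  fixes T :: "'a::chilbert_space \<Rightarrow> 'a"
  assumes "bounded_clinear T"
  shows "cinner (cadjoint T x) y = cinner x (T y)"
  by (simp add: cinner_commute[of "cadjoint T x" y] cinner_commute[of x "T y"]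
      cinner_cadjoint[OF assms])

lemma cinner_re_op:
  fixes T :: "'a::chilbert_space \<Rightarrow> 'a"
  assumes "bounded_clinear T"
  shows "cinner (re_op T x) y = (cinner (T x) y + cinner x (T y)) / 2"
  by (simp add: re_op_def cinner_scaleC_left cinner_add_left cinner_cadjoint'[OF assms])

lemma re_op_selfadjoint:
  fixes T :: "'a::chilbert_space \<Rightarrow> 'a"
  assumes "bounded_clinear T"
  shows "cinner (re_op T x) y = cinner x (re_op T y)"
proof -
  have "cinner x (re_op T y) = cnj (cinner (re_op T y) x)" by (rule cinner_commute)
  also have "\<dots> = (cinner x (T y) + cinner (T x) y) / 2"
    unfolding cinner_re_op[OF assms] by (simp flip: cinner_commute)
  finally show ?thesis by (simp add: cinner_re_op[OF assms] add.commute)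
qed

text \<open>Realness of the form at \<open>x + y\<close> makes the imaginary parts of the cross
  terms cancel; replacing \<open>x\<close> by \<open>\<i> *\<^sub>C x\<close> then handles the real
  parts.\<close>

lemma selfadjoint_of_real_form:
  fixes T :: "'a::complex_inner \<Rightarrow> 'a"
  assumes T: "bounded_clinear T" and real: "\<And>x. cinner (T x) x \<in> \<real>"
  shows "cinner (T x) y = cinner x (T y)"
proof -
  interpret T: bounded_linear T using T by (simp add: bounded_clinear_def)
  have hom: "\<And>c x. T (c *\<^sub>C x) = c *\<^sub>C T x" using T by (simp add: bounded_clinear_def)
  have im: "Im (cinner (T x) y) = Im (cinner x (T y))" for x y
  proof -
    have "Im (cinner (T (x + y)) (x + y)) = 0" "Im (cinner (T x) x) = 0" "Im (cinner (T y) y) = 0"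
      using real by (auto simp: complex_is_Real_iff)
    then have "Im (cinner (T x) y) = - Im (cinner (T y) x)"
      by (simp add: T.add cinner_add_left cinner_add_right)
    also have "\<dots> = Im (cinner x (T y))" by (subst cinner_commute) simp
    finally show ?thesis .
  qed
  show ?thesis
    using im[of x y] im[of "\<i> *\<^sub>C x" y]
    by (intro complex_eqI) (simp_all add: hom cinner_scaleC_left)
qed

subsection \<open>Norm and numerical radius\<close>

text \<open>Polarisation: \<open>4 \<langle>Rx, y\<rangle> = \<langle>R(x+y), x+y\<rangle> - \<langle>R(x-y), x-y\<rangle>\<close>.\<close>

lemma onorm_symmetric_le:
  fixes R :: "'a::real_inner \<Rightarrow> 'a"
  assumes R: "bounded_linear R" and sym: "\<And>x y. inner (R x) y = inner x (R y)"
    and w0: "0 \<le> w" and w: "\<And>x. \<bar>inner (R x) x\<bar> \<le> w * (norm x)\<^sup>2"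
  shows "onorm R \<le> w"
proof -
  interpret R: bounded_linear R by (rule R)
  have pol: "4 * inner (R x) y \<le> 2 * w * ((norm x)\<^sup>2 + (norm y)\<^sup>2)" for x y
  proof -
    have "4 * inner (R x) y = inner (R (x + y)) (x + y) - inner (R (x - y)) (x - y)"
      using sym[of y x] by (simp add: R.add R.diff inner_simps inner_commute)
    also have "\<dots> \<le> w * (norm (x + y))\<^sup>2 + w * (norm (x - y))\<^sup>2"
      using w[of "x + y"] w[of "x - y"] by linarith
    also have "\<dots> = 2 * w * ((norm x)\<^sup>2 + (norm y)\<^sup>2)"
      unfolding power2_norm_eq_inner by (simp add: inner_simps inner_commute algebra_simps)
    finally show ?thesis .
  qed
  have bound: "norm (R x) \<le> w * norm x" for x
  proof (cases "R x = 0 \<or> x = 0")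
    case True
    then show ?thesis using w0 by (auto simp: R.zero)
  next
    case False
    \<comment> \<open>\<open>R x\<close> rescaled to the length of \<open>x\<close>, so that both
      squares in \<open>pol\<close> agree and the inner product is
      \<open>norm x * norm (R x)\<close>.\<close>
    define y where "y = (norm x / norm (R x)) *\<^sub>R R x"
    have "inner (R x) y = norm x * norm (R x)"
      using False by (simp add: y_def power2_eq_square flip: power2_norm_eq_inner)
    moreover have "norm y = norm x" using False by (simp add: y_def)
    ultimately have "norm x * norm (R x) \<le> norm x * (w * norm x)"
      using pol[of x y] by (simp add: power2_eq_square algebra_simps)
    then show ?thesis using False by simp
  qed
  show ?thesis by (rule onorm_bound[OF w0 bound])
qed

text \<open>By \<open>onorm_symmetric_le\<close> the quadratic form comes arbitrarily close to the
  norm \<open>N\<close> in modulus, and at a unit vector \<open>x\<close> the squared defect is at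
  most \<open>2 * N * (N - \<bar>inner (R x) x\<bar>)\<close>.\<close>

lemma exists_approx_eigenvector:
  fixes R :: "'a::real_inner \<Rightarrow> 'a"
  assumes R: "bounded_linear R" and sym: "\<And>x y. inner (R x) y = inner x (R y)"
    and pos: "onorm R > 0" and e: "e > 0"
  obtains x \<mu> where "norm x = 1" "\<bar>\<mu>\<bar> = onorm R" "norm (R x - \<mu> *\<^sub>R x) < e"
proof -
  interpret R: bounded_linear R by (rule R)
  define N where "N = onorm R"
  \<comment> \<open>Chosen so that \<open>2 * N * (N - w)\<close> is at most
    \<open>e\<^sup>2\<close>; the maximum with 0 supplies the sign condition of
    \<open>onorm_symmetric_le\<close>.\<close>
  define w where "w = max 0 (N - e\<^sup>2 / (2 * N))"
  have N: "N > 0" using pos by (simp add: N_def)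
  have "w < N" using N e by (simp add: w_def)
  moreover have "0 \<le> w" by (simp add: w_def)
  ultimately have "\<not> (\<forall>x. \<bar>inner (R x) x\<bar> \<le> w * (norm x)\<^sup>2)"
    using onorm_symmetric_le[OF R sym, of w] by (auto simp: N_def)
  then obtain y where y: "\<bar>inner (R y) y\<bar> > w * (norm y)\<^sup>2" by (auto simp: not_le)
  then have "y \<noteq> 0" by (auto simp: R.zero)
  define x where "x = (1 / norm y) *\<^sub>R y"
  have x: "norm x = 1" using \<open>y \<noteq> 0\<close> by (simp add: x_def)
  have "\<bar>inner (R x) x\<bar> = \<bar>inner (R y) y\<bar> / (norm y)\<^sup>2"
    by (simp add: x_def R.scaleR power2_eq_square abs_mult)
  then have wx: "\<bar>inner (R x) x\<bar> > w" using y \<open>y \<noteq> 0\<close> by (simp add: pos_less_divide_eq)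
  define \<mu> where "\<mu> = (if inner (R x) x \<ge> 0 then N else - N)"
  have "(norm (R x - \<mu> *\<^sub>R x))\<^sup>2 = (norm (R x))\<^sup>2 - 2 * \<mu> * inner (R x) x + \<mu>\<^sup>2 * (norm x)\<^sup>2"
    unfolding power2_norm_eq_inner by (simp add: inner_simps inner_commute power2_eq_square)
  also have "\<dots> = (norm (R x))\<^sup>2 - 2 * N * \<bar>inner (R x) x\<bar> + N\<^sup>2"
    by (simp add: \<mu>_def x)
  also have "\<dots> \<le> N\<^sup>2 - 2 * N * \<bar>inner (R x) x\<bar> + N\<^sup>2"
    using onorm[OF R, of x] by (simp add: N_def x power_mono)
  also have "\<dots> < N\<^sup>2 - 2 * N * w + N\<^sup>2" using wx N by simp
  also have "\<dots> = 2 * N * (N - w)" by (simp add: algebra_simps power2_eq_square)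
  also have "\<dots> \<le> 2 * N * (e\<^sup>2 / (2 * N))" using N by (intro mult_left_mono) (auto simp: w_def)
  also have "\<dots> = e\<^sup>2" using N by simp
  finally have "norm (R x - \<mu> *\<^sub>R x) < e" using e by (simp add: power_less_imp_less_base)
  moreover have "\<bar>\<mu>\<bar> = onorm R" using N by (simp add: \<mu>_def N_def)
  ultimately show thesis using x that by blast
qed

text \<open>Boundedness of \<open>S\<close> bounds the set under the supremum by
  \<open>onorm S\<close>, which makes the real \<open>SUP\<close> an upper bound.\<close>

lemma cmod_cinner_le_numerical_radius:
  fixes S :: "'a::complex_inner \<Rightarrow> 'a"
  assumes S: "bounded_linear S" and x: "norm x = 1"
  shows "cmod (cinner (S x) x) \<le> numerical_radius S"
proof -
  have "cmod (cinner (S y) y) \<le> onorm S" if "norm y = 1" for y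
    using cmod_cinner_le[of "S y" y] onorm[OF S, of y] that by simp
  then have "bdd_above ((\<lambda>x. cmod (cinner (S x) x)) ` {x. norm x = 1})" by (intro bdd_aboveI2) auto
  then show ?thesis using x unfolding numerical_radius_def by (auto intro: cSUP_upper)
qed

text \<open>The condition \<open>0 \<le> w\<close> covers the zero space, where the numerical radius
  is 0 by convention.\<close>

lemma numerical_radius_le:
  fixes S :: "'a::complex_inner \<Rightarrow> 'a"
  assumes "0 \<le> w" and "\<And>x. norm x = 1 \<Longrightarrow> cmod (cinner (S x) x) \<le> w"
  shows "numerical_radius S \<le> w"
  using assms unfolding numerical_radius_def by (auto intro!: cSUP_least)

lemma bounded_linear_scaleC: "bounded_linear (\<lambda>x::'a::complex_inner. c *\<^sub>C x)"
proof (rule bounded_linear_intro)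
  show "c *\<^sub>C (r *\<^sub>R x) = r *\<^sub>R c *\<^sub>C x" for r and x :: 'a
    by (simp add: scaleR_scaleC scaleC_scaleC mult.commute)
  show "norm (c *\<^sub>C x) \<le> norm x * cmod c" for x :: 'a
    by (simp add: norm_scaleC mult.commute)
qed (rule scaleC_add_right)

text \<open>Turning \<open>d\<close> back through twice its argument reflects it in the real
  axis.\<close>

lemma exists_rotation_to_cnj: "\<exists>\<theta>::real. exp (\<i> * complex_of_real \<theta>) * d = cnj d"
proof -
  have "exp (\<i> * complex_of_real (- 2 * Arg d)) * d
      = cmod d * (exp (\<i> * complex_of_real (- 2 * Arg d)) * exp (\<i> * complex_of_real (Arg d)))"
    using Arg_eq[of d] by (cases "d = 0") auto
  also have "\<dots> = cnj (cmod d * exp (\<i> * complex_of_real (Arg d)))"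
    by (simp add: exp_cnj flip: exp_add)
  also have "\<dots> = cnj d" using Arg_eq[of d] by (cases "d = 0") auto
  finally show ?thesis by blast
qed


theorem theorem2p11:
  fixes A B X :: "'a::chilbert_space \<Rightarrow> 'a" and m :: real
  assumes "bounded_clinear A" and "bounded_clinear B" and "bounded_clinear X"
    and "m > 0"
    and "positive_op (\<lambda>x. X x - complex_of_real m *\<^sub>C x)"
  shows "m * onorm (\<lambda>x. re_op A x - re_op B x)
           \<le> numerical_radius (\<lambda>x. re_op A (X x) - X (re_op B x))
    \<and> numerical_radius (\<lambda>x. re_op A (X x) - X (re_op B x))
           \<le> 1/2 * (SUP \<theta>::real. onorm (\<lambda>x. (A (X x) - X (B x))
                 + exp (\<i> * complex_of_real \<theta>) *\<^sub>C (X (A x) - B (X x))))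
    \<and> 1/2 * (SUP \<theta>::real. onorm (\<lambda>x. (A (X x) - X (B x))
                 + exp (\<i> * complex_of_real \<theta>) *\<^sub>C (X (A x) - B (X x))))
           \<le> (onorm (\<lambda>x. A (X x) - X (B x)) + onorm (\<lambda>x. X (A x) - B (X x))) / 2"
proof -
  define P Q where "P = re_op A" and "Q = re_op B"
  define R where "R x = P x - Q x" for x
  define S where "S x = P (X x) - X (Q x)" for x
  define C D where "C x = A (X x) - X (B x)" and "D x = X (A x) - B (X x)" for x
  define F where "F \<theta> x = C x + exp (\<i> * complex_of_real \<theta>) *\<^sub>C D x" for \<theta> :: real and x
  have linA: "bounded_linear A" and linB: "bounded_linear B" and linX: "bounded_linear X"
    using assms by (auto simp: bounded_clinear_def)
  have linP: "bounded_linear P" and linQ: "bounded_linear Q"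
    unfolding P_def Q_def using assms by (auto intro: bounded_linear_re_op)
  note comp = bounded_linear_compose
  have linR: "bounded_linear R" and linS: "bounded_linear S"
    and linC: "bounded_linear C" and linD: "bounded_linear D"
    unfolding R_def[abs_def] S_def[abs_def] C_def[abs_def] D_def[abs_def]
    by (intro bounded_linear_sub linP linQ comp[OF linP linX] comp[OF linX linQ]
        comp[OF linA linX] comp[OF linX linB] comp[OF linX linA] comp[OF linB linX])+
  have linE: "bounded_linear (\<lambda>x. exp (\<i> * complex_of_real \<theta>) *\<^sub>C D x)" for \<theta> :: real
    by (rule comp[OF bounded_linear_scaleC linD])
  have linF: "bounded_linear (F \<theta>)" for \<theta>
    unfolding F_def[abs_def] by (intro bounded_linear_add linC linE)

  have posX: "cinner (X x) x - m * cinner x x \<in> \<real>\<^sub>\<ge>\<^sub>0" for x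
    using assms(5) by (simp add: positive_op_def cinner_diff_left cinner_scaleC_left)
  have "cinner (X x) x \<in> \<real>" for x
    using posX[of x] by (simp add: cinner_self complex_is_Real_iff complex_nonneg_Reals_iff)
  then have selfX: "cinner (X x) y = cinner x (X y)" for x y
    by (rule selfadjoint_of_real_form[OF assms(3)])
  have Xm: "m * (norm x)\<^sup>2 \<le> inner (X x) x" for x
    using posX[of x] by (simp add: cinner_self complex_nonneg_Reals_iff inner_eq_Re_cinner)
  have selfP: "cinner (P x) y = cinner x (P y)" and selfQ: "cinner (Q x) y = cinner x (Q y)" for x y
    unfolding P_def Q_def using assms by (auto intro: re_op_selfadjoint)
  have symR: "inner (R x) y = inner x (R y)" for x y
    by (simp add: inner_eq_Re_cinner R_def cinner_diff_left cinner_diff_right selfP selfQ)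

  have w: "\<bar>inner (X x) (R x)\<bar> \<le> numerical_radius S" if "norm x = 1" for x
  proof -
    have "Re (cinner (S x) x) = Re (cinner (X x) (P x)) - Re (cinner (Q x) (X x))"
      by (simp add: S_def cinner_diff_left selfP selfX)
    also have "Re (cinner (Q x) (X x)) = Re (cinner (X x) (Q x))"
      by (subst cinner_commute) simp
    finally have "Re (cinner (S x) x) = inner (X x) (R x)"
      by (simp add: inner_eq_Re_cinner R_def cinner_diff_right)
    then show ?thesis
      using cmod_cinner_le_numerical_radius[OF linS that] abs_Re_le_cmod[of "cinner (S x) x"] by simp
  qed

  have first: "m * onorm R \<le> numerical_radius S"
  proof (cases "onorm R > 0")
    case True
    show ?thesis
    proof (rule field_le_epsilon)
      fix e :: real assume e: "e > 0"
      \<comment> \<open>The added 1 makes the divisor positive; a defect below \<open>e / k\<close>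
        costs at most \<open>e\<close> after pairing with \<open>X x\<close>, because
        \<open>norm (X x)\<close> is at most \<open>k\<close>.\<close>
      define k where "k = onorm X + 1"
      have k: "k > 0" using onorm_pos_le[OF linX] by (simp add: k_def)
      obtain x \<mu> where x: "norm x = 1" and \<mu>: "\<bar>\<mu>\<bar> = onorm R"
        and approx: "norm (R x - \<mu> *\<^sub>R x) < e / k"
        using exists_approx_eigenvector[OF linR symR True, of "e / k"] e k by auto
      have "\<bar>inner (X x) (R x - \<mu> *\<^sub>R x)\<bar> \<le> norm (X x) * norm (R x - \<mu> *\<^sub>R x)"
        by (rule Cauchy_Schwarz_ineq2)
      also have "\<dots> \<le> k * (e / k)"
        using onorm[OF linX, of x] approx k x by (intro mult_mono) (auto simp: k_def)
      finally have err: "\<bar>inner (X x) (R x) - \<mu> * inner (X x) x\<bar> \<le> e"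
        using k by (simp add: inner_diff_right)
      have "m * onorm R \<le> inner (X x) x * \<bar>\<mu>\<bar>"
        using Xm[of x] x True by (simp add: \<mu>)
      also have "\<dots> = \<bar>\<mu> * inner (X x) x\<bar>"
        using Xm[of x] x assms(4) by (simp add: abs_mult)
      also have "\<dots> \<le> \<bar>inner (X x) (R x)\<bar> + e" using err by linarith
      finally show "m * onorm R \<le> numerical_radius S + e" using w[OF x] by linarith
    qed
  next
    case False
    then have zero: "onorm R = 0" using onorm_pos_le[OF linR] by linarith
    \<comment> \<open>The left side vanishes, so nonnegativity suffices; on the zero space it comes
      from the default value.\<close>
    have "0 \<le> numerical_radius S"
    proof (cases "\<exists>x::'a. norm x = 1")
      case True
      then obtain x :: 'a where x: "norm x = 1" by blast
      then show ?thesis using w[OF x] by linarith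
    qed (simp add: numerical_radius_def)
    then show ?thesis using zero by simp
  qed

  \<comment> \<open>The rotation preserves norms, so the bound is uniform in
    \<open>\<theta>\<close>. It both makes the supremum meaningful and gives the third
    inequality.\<close>
  have boundF: "onorm (F \<theta>) \<le> onorm C + onorm D" for \<theta>
  proof -
    have "onorm (F \<theta>) \<le> onorm C + onorm (\<lambda>x. exp (\<i> * complex_of_real \<theta>) *\<^sub>C D x)"
      unfolding F_def[abs_def] by (rule onorm_triangle[OF linC linE])
    also have "onorm (\<lambda>x. exp (\<i> * complex_of_real \<theta>) *\<^sub>C D x) = onorm D"
      by (simp add: onorm_def norm_scaleC)
    finally show ?thesis by simp
  qed
  then have bdd: "bdd_above (range (\<lambda>\<theta>. onorm (F \<theta>)))" by (intro bdd_aboveI2)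
  have supF: "onorm (F \<theta>) \<le> (SUP \<theta>. onorm (F \<theta>))" for \<theta>
    by (rule cSUP_upper[OF _ bdd]) simp

  have second: "numerical_radius S \<le> 1/2 * (SUP \<theta>. onorm (F \<theta>))"
  proof (rule numerical_radius_le)
    show "0 \<le> 1/2 * (SUP \<theta>. onorm (F \<theta>))"
      using supF[of 0] onorm_pos_le[OF linF[of 0]] by simp
  next
    fix x :: 'a assume x: "norm x = 1"
    obtain \<theta> :: real where \<theta>: "exp (\<i> * complex_of_real \<theta>) * cinner (D x) x = cnj (cinner (D x) x)"
      using exists_rotation_to_cnj by blast
    \<comment> \<open>The two terms with \<open>x\<close> or \<open>X x\<close> first and
      \<open>A\<close> or \<open>B\<close> on the right combine, after moving \<open>X\<close>
      across in the \<open>A\<close> term, to the conjugate of \<open>cinner (D x) x\<close>. The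
      rotation \<open>\<theta>\<close> depends on \<open>x\<close>, hence the supremum.\<close>
    have "2 * cinner (S x) x = (cinner (A (X x)) x + cinner (X x) (A x))
        - (cinner (B x) (X x) + cinner x (B (X x)))"
      by (simp add: S_def P_def Q_def cinner_diff_left selfX[of "re_op B x"] cinner_re_op assms(1,2)
          field_simps)
    also have "\<dots> = cinner (C x) x + cnj (cinner (D x) x)"
      by (simp add: C_def D_def cinner_diff_left selfX cinner_commute[of x "B (X x)"]
          cinner_commute[of x "X (A x)"])
    also have "\<dots> = cinner (F \<theta> x) x"
      by (simp add: F_def cinner_add_left cinner_scaleC_left \<theta>)
    finally have "cmod (2 * cinner (S x) x) = cmod (cinner (F \<theta> x) x)" by simp
    then have "2 * cmod (cinner (S x) x) = cmod (cinner (F \<theta> x) x)" by (simp add: norm_mult)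
    also have "\<dots> \<le> onorm (F \<theta>)"
      using cmod_cinner_le[of "F \<theta> x" x] onorm[OF linF, of \<theta> x] x by simp
    also have "\<dots> \<le> (SUP \<theta>. onorm (F \<theta>))" by (rule supF)
    finally show "cmod (cinner (S x) x) \<le> 1/2 * (SUP \<theta>. onorm (F \<theta>))" by simp
  qed

  have third: "1/2 * (SUP \<theta>. onorm (F \<theta>)) \<le> (onorm C + onorm D) / 2"
    using cSUP_least[OF UNIV_not_empty boundF] by simp
  show ?thesis
    using first second third
    unfolding R_def[abs_def] S_def[abs_def] F_def[abs_def] C_def[abs_def] D_def[abs_def] P_def Q_def
    by (intro conjI)
qed

end
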